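(* If $G$ is a connected unicyclic graph (i.e. a connected graph whose number of edges equals its number of vertices), then ${\rm gp}(G)\geq {\rm Z}(G)$.
   Context: All graphs are finite and simple. Zero forcing: given a set $S\subseteq V(G)$ of initially black vertices (all others white), the color-change rule turns a white vertex $y$ black if $y$ is the only white neighbor of some black vertex $x$. The zero forcing number ${\rm Z}(G)$ is the minimum size of a set $S$ such that repeated application of the color-change rule eventually turns all vertices of $G$ black. A set $R\subseteq V(G)$ is a general position set if no three vertices of $R$ lie on a common shortest path of $G$; the general position number ${\rm gp}(G)$ is the maximum size of a general position set of $G$. *)

theory Defs
  imports "Graph_Theory.Digraph_Component" "Graph_Theory.Vertex_Walk"
begin

text \<open>
  A finite simple graph is a \<^locale>\<open>graph\<close>: a symmetric digraph without loops or parallel arcs,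
  so each undirected edge is represented by two opposite arcs.
\<close>

definition edges :: "('a, 'b) pre_digraph \<Rightarrow> 'a set set" where
  "edges G = {{u, v} | u v. u \<rightarrow>\<^bsub>G\<^esub> v}"

definition color_change :: "('a, 'b) pre_digraph \<Rightarrow> 'a set \<Rightarrow> 'a set \<Rightarrow> bool" where
  "color_change G B C \<longleftrightarrow>
     (\<exists>x \<in> B. \<exists>y. {z \<in> verts G - B. x \<rightarrow>\<^bsub>G\<^esub> z} = {y} \<and> C = insert y B)"

text \<open>
  Forces are performed one at a time. A force that is available stays available, or its target has
  become black, as the black set grows; so the order of the forces does not matter.
\<close>

definition zero_forcing_set :: "('a, 'b) pre_digraph \<Rightarrow> 'a set \<Rightarrow> bool" where
  "zero_forcing_set G S \<longleftrightarrow> S \<subseteq> verts G \<and> (color_change G)\<^sup>*\<^sup>* S (verts G)"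

definition zero_forcing_number :: "('a, 'b) pre_digraph \<Rightarrow> nat" where
  "zero_forcing_number G = Min (card ` {S. zero_forcing_set G S})"

definition shortest_path :: "('a, 'b) pre_digraph \<Rightarrow> 'a vwalk \<Rightarrow> bool" where
  "shortest_path G p \<longleftrightarrow> vpath p G \<and>
     (\<forall>q. vpath q G \<and> hd q = hd p \<and> last q = last p \<longrightarrow> vwalk_length p \<le> vwalk_length q)"

definition general_position_set :: "('a, 'b) pre_digraph \<Rightarrow> 'a set \<Rightarrow> bool" where
  "general_position_set G R \<longleftrightarrow> R \<subseteq> verts G \<and>
     \<not> (\<exists>T p. T \<subseteq> R \<and> card T = 3 \<and> shortest_path G p \<and> T \<subseteq> set p)"

definition gp_number :: "('a, 'b) pre_digraph \<Rightarrow> nat" where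
  "gp_number G = Max (card ` {R. general_position_set G R})"

text \<open>
  The sets under \<^const>\<open>Min\<close> and \<^const>\<open>Max\<close> are finite and nonempty for every finite graph, so both
  numbers are attained.
\<close>

lemma finite_zero_forcing_sets: "finite (verts G) \<Longrightarrow> finite {S. zero_forcing_set G S}"
  by (rule finite_subset[of _ "Pow (verts G)"]) (auto simp: zero_forcing_set_def)

lemma zero_forcing_set_verts: "zero_forcing_set G (verts G)"
  by (simp add: zero_forcing_set_def)

lemma finite_general_position_sets: "finite (verts G) \<Longrightarrow> finite {R. general_position_set G R}"
  by (rule finite_subset[of _ "Pow (verts G)"]) (auto simp: general_position_set_def)

lemma general_position_set_empty: "general_position_set G {}"
  by (auto simp: general_position_set_def)

end

theory Submission
  imports Defs
begin

text \<open>
  Every nonempty set \<open>F\<close> of edges of a connected unicyclic graph spans at least \<open>|F|\<close> vertices; call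
  \<open>F\<close> tight if equality holds. Tight sets are closed under intersection, so there is a least one, the
  cycle \<open>C\<close>. If the color change rule is stuck at a black set, consider the edges meeting a white
  vertex: a black vertex on such an edge lies on at least two of them, and a white vertex that is not
  a leaf has full degree, at least 2. So if all leaves but at most one are black, these edges form a
  tight set by handshaking; in particular they contain \<open>C\<close>, and hardly any degree exceeds 2.

  Let \<open>L\<close> be the set of leaves, which is in general position, and call a vertex of \<open>C\<close> of degree at
  least 3 a branch vertex. Without branch vertices the graph is a cycle and the ends of an edge force
  it. With a single branch vertex \<open>v\<close> and \<open>a\<close> a neighbour of \<open>v\<close> on \<open>C\<close>, the set \<open>L \<union> {a}\<close> is both
  forcing and in general position. With two branch vertices, one can trade an arbitrary leaf of
  \<open>L\<close> for a neighbour on \<open>C\<close> of one of them and obtain a forcing set of at most \<open>|L|\<close> vertices.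
\<close>

section \<open>Degrees in a set of edges, and splitting of lists\<close>

definition degree :: "'a set set \<Rightarrow> 'a \<Rightarrow> nat" where
  "degree F x = card {e \<in> F. x \<in> e}"

lemma degree_mono: "finite F' \<Longrightarrow> F \<subseteq> F' \<Longrightarrow> degree F x \<le> degree F' x"
  unfolding degree_def by (intro card_mono) auto

lemma card_filter_less:
  assumes "finite A" "a \<in> A" "\<not> P a" "Q a" "\<And>x. x \<in> A \<Longrightarrow> P x \<Longrightarrow> Q x"
  shows "card {x \<in> A. P x} < card {x \<in> A. Q x}"
proof (rule psubset_card_mono)
  show "{x \<in> A. P x} \<subset> {x \<in> A. Q x}" using assms by blast
qed (use assms in simp)

text \<open>General position is tested at the middle one of three points on a path. Cutting at the
  first element of \<open>T\<close> and then at the next one exhibits it, with elements of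
  \<open>T\<close> left over on both sides.\<close>

lemma triple_split_list:
  assumes "T \<subseteq> set p" "card T = 3"
  shows "\<exists>q m r. p = q @ m # r \<and> m \<in> T \<and> set q \<inter> T \<noteq> {} \<and> set r \<inter> T \<noteq> {}"
proof -
  have "\<exists>x\<in>set p. x \<in> T"
    using assms by (metis card.empty equals0I subsetD zero_neq_numeral)
  then obtain q x r where p: "p = q @ x # r" and x: "x \<in> T" and q: "\<forall>y\<in>set q. y \<notin> T"
    by (rule split_list_first_propE) blast
  have sub: "T - {x} \<subseteq> set r" using assms(1) p q by auto
  have c2: "card (T - {x}) = 2" using x assms(2) by simp
  then have "\<exists>y\<in>set r. y \<in> T - {x}"
    using sub by (metis card.empty equals0I subsetD zero_neq_numeral)
  then obtain s y t where r: "r = s @ y # t" and y: "y \<in> T - {x}" and s: "\<forall>z\<in>set s. z \<notin> T - {x}"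
    by (rule split_list_first_propE) blast
  have "T - {x} - {y} \<subseteq> set t" using sub r s by auto
  moreover have "card (T - {x} - {y}) = 1" using c2 y by simp
  ultimately have "set t \<inter> T \<noteq> {}" by (auto simp: card_1_singleton_iff)
  moreover have "p = (q @ x # s) @ y # t" using p r by simp
  ultimately show ?thesis using x y by (metis DiffD1 Int_iff empty_iff in_set_conv_decomp)
qed

text \<open>The last entry of \<open>p\<close> outside \<open>X\<close> is followed by a member of
  \<open>X\<close>, which may be the final \<open>a\<close>.\<close>

lemma successively_enters:
  assumes "successively P (p @ [a])" "a \<in> X" "x \<in> set p" "x \<notin> X"
  shows "\<exists>s\<in>set p. \<exists>t\<in>X. s \<notin> X \<and> P s t"
proof -
  have "\<exists>x\<in>set p. x \<notin> X" using assms by blast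
  then obtain q s r where p: "p = q @ s # r" and s: "s \<notin> X" and r: "\<forall>y\<in>set r. \<not> y \<notin> X"
    by (rule split_list_last_propE) blast
  have "P s (hd (r @ [a]))"
    using assms(1) p by (cases r) (auto simp: successively_append_iff successively_Cons)
  moreover have "hd (r @ [a]) \<in> X" using r assms(2) by (cases r) auto
  ultimately show ?thesis using p s by auto
qed

section \<open>Counting edges in a connected graph\<close>

text \<open>Connectedness enters as the cut condition \<open>crossing\<close>, the form needed to
  grow a vertex set one vertex at a time.\<close>

locale unicyclic =
  fixes V :: "'a set" and E :: "'a set set"
  assumes finite_V: "finite V"
    and edge: "e \<in> E \<Longrightarrow> e \<subseteq> V \<and> card e = 2"
    and crossing: "X \<subseteq> V \<Longrightarrow> X \<noteq> {} \<Longrightarrow> X \<noteq> V \<Longrightarrow> \<exists>x\<in>X. \<exists>y\<in>V - X. {x, y} \<in> E"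
    and card_E: "card E = card V"
    and V_nonempty: "V \<noteq> {}"
begin

lemma finite_E: "finite E"
  by (rule finite_subset[of _ "Pow V"]) (use edge finite_V in auto)

lemma edge_pair: "e \<in> E \<Longrightarrow> x \<in> e \<Longrightarrow> \<exists>y. y \<noteq> x \<and> y \<in> V \<and> e = {x, y}"
  using edge[of e] by (auto simp: card_2_iff)

text \<open>Let \<open>X\<close> absorb the other vertices one by one along crossing edges: each
  such edge then lies inside the grown set and drops out of the count.\<close>

lemma card_edges_leaving:
  assumes "X \<subseteq> V" "X \<noteq> {}"
  shows "card (V - X) \<le> card {e \<in> E. \<not> e \<subseteq> X}"
  using assms
proof (induction "card (V - X)" arbitrary: X)
  case (Suc n)
  then have "X \<noteq> V" by auto
  then obtain x y where xy: "x \<in> X" "y \<in> V - X" "{x, y} \<in> E"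
    using crossing Suc.prems by blast
  have V: "V - X = insert y (V - insert y X)" using xy by auto
  have c: "card (V - X) = Suc (card (V - insert y X))"
    by (subst V) (use finite_V in auto)
  have "card (V - insert y X) \<le> card {e \<in> E. \<not> e \<subseteq> insert y X}"
  proof (rule Suc.hyps(1))
    show "n = card (V - insert y X)" using c Suc.hyps(2) by linarith
  qed (use Suc.prems xy in auto)
  moreover have "card {e \<in> E. \<not> e \<subseteq> insert y X} < card {e \<in> E. \<not> e \<subseteq> X}"
    using xy by (intro card_filter_less[OF finite_E xy(3)]) auto
  ultimately show ?case using c by simp
qed simp

text \<open>Grow \<open>X\<close> until a crossing edge ends in \<open>Y\<close>. That edge joins
  the two sets without absorbing a vertex, which makes the inequality strict.\<close>

lemma card_edges_leaving_two:
  assumes "X \<subseteq> V" "X \<noteq> {}" "Y \<subseteq> V" "Y \<noteq> {}" "X \<inter> Y = {}"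
  shows "card (V - (X \<union> Y)) < card {e \<in> E. \<not> e \<subseteq> X \<and> \<not> e \<subseteq> Y}"
  using assms
proof (induction "card (V - (X \<union> Y))" arbitrary: X rule: less_induct)
  case less
  have "X \<noteq> V" using less.prems(3-5) by blast
  then obtain x y where xy: "x \<in> X" "y \<in> V - X" "{x, y} \<in> E"
    using crossing[OF less.prems(1,2)] by blast
  show ?case
  proof (cases "y \<in> Y")
    case True
    have "card (V - (X \<union> Y)) \<le> card {e \<in> E. \<not> e \<subseteq> X \<union> Y}"
      by (rule card_edges_leaving) (use less.prems in auto)
    also have "\<dots> < card {e \<in> E. \<not> e \<subseteq> X \<and> \<not> e \<subseteq> Y}"
      using xy True less.prems by (intro card_filter_less[OF finite_E xy(3)]) auto
    finally show ?thesis .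
  next
    case False
    have V: "V - (X \<union> Y) = insert y (V - (insert y X \<union> Y))" using xy False by auto
    have c: "card (V - (X \<union> Y)) = Suc (card (V - (insert y X \<union> Y)))"
      by (subst V) (use finite_V in auto)
    have "card (V - (insert y X \<union> Y)) < card {e \<in> E. \<not> e \<subseteq> insert y X \<and> \<not> e \<subseteq> Y}"
    proof (rule less.hyps)
      show "card (V - (insert y X \<union> Y)) < card (V - (X \<union> Y))" using c by linarith
    qed (use less.prems xy False in auto)
    moreover have "card {e \<in> E. \<not> e \<subseteq> insert y X \<and> \<not> e \<subseteq> Y} < card {e \<in> E. \<not> e \<subseteq> X \<and> \<not> e \<subseteq> Y}"
      using xy False less.prems by (intro card_filter_less[OF finite_E xy(3)]) auto
    ultimately show ?thesis using c by simp
  qed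
qed

lemma finite_edge_subset: "F \<subseteq> E \<Longrightarrow> finite F \<and> finite (\<Union>F) \<and> \<Union>F \<subseteq> V"
  using finite_subset[OF _ finite_E, of F] finite_subset[OF _ finite_V, of "\<Union>F"] edge by blast

lemma Union_nonempty: "F \<subseteq> E \<Longrightarrow> F \<noteq> {} \<Longrightarrow> \<Union>F \<noteq> {}"
  using edge by fastforce

text \<open>The vertices outside \<open>\<Union>F\<close> require at least as many edges outside
  \<open>F\<close> by \<open>card_edges_leaving\<close>, and there are only \<open>card V\<close>
  edges in all.\<close>

lemma card_le_card_Union:
  assumes "F \<subseteq> E" "F \<noteq> {}"
  shows "card F \<le> card (\<Union>F)"
proof -
  let ?X = "\<Union>F"
  have "card (V - ?X) \<le> card {e \<in> E. \<not> e \<subseteq> ?X}"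
    using assms finite_edge_subset Union_nonempty by (intro card_edges_leaving) auto
  moreover have "card F + card {e \<in> E. \<not> e \<subseteq> ?X} = card (F \<union> {e \<in> E. \<not> e \<subseteq> ?X})"
    using finite_E assms finite_edge_subset by (intro card_Un_disjoint[symmetric]) auto
  moreover have "\<dots> \<le> card V"
    unfolding card_E[symmetric] using finite_E assms by (intro card_mono) auto
  moreover have "card (V - ?X) = card V - card ?X" "card ?X \<le> card V"
    using finite_edge_subset[OF assms(1)] finite_V by (auto intro!: card_Diff_subset card_mono)
  ultimately show ?thesis by linarith
qed

lemma sum_degree:
  assumes "F \<subseteq> E"
  shows "(\<Sum>x\<in>\<Union>F. degree F x) = 2 * card F"
proof -
  have "(\<Sum>x\<in>\<Union>F. degree F x) = (\<Sum>x\<in>\<Union>F. \<Sum>e\<in>F. if x \<in> e then 1 else 0)"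
    unfolding degree_def using assms finite_edge_subset by (intro sum.cong) (auto simp: sum.If_cases Int_def)
  also have "\<dots> = (\<Sum>e\<in>F. \<Sum>x\<in>\<Union>F. if x \<in> e then 1 else 0)"
    by (rule sum.swap)
  also have "\<dots> = (\<Sum>e\<in>F. 2)"
  proof (rule sum.cong)
    fix e assume e: "e \<in> F"
    then have "\<Union>F \<inter> {x. x \<in> e} = e" by auto
    then show "(\<Sum>x\<in>\<Union>F. if x \<in> e then 1 else 0) = (2 :: nat)"
      using edge[of e] e assms finite_edge_subset[OF assms] by (auto simp: sum.If_cases)
  qed simp
  finally show ?thesis by simp
qed

section \<open>Tight sets of edges\<close>

text \<open>In graph terms these are the connected subgraphs that contain the cycle.\<close>

definition tight :: "'a set set \<Rightarrow> bool" where
  "tight F \<longleftrightarrow> F \<subseteq> E \<and> F \<noteq> {} \<and> card F = card (\<Union>F)"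

text \<open>Two vertex-disjoint tight sets, together with the edges that link them and the remaining
  vertices, would number more than \<open>card V\<close>; this is where the strictness in
  \<open>card_edges_leaving_two\<close> counts.\<close>

lemma tight_inter_nonempty:
  assumes "tight F" "tight F'"
  shows "\<Union>F \<inter> \<Union>F' \<noteq> {}"
proof
  assume disj: "\<Union>F \<inter> \<Union>F' = {}"
  let ?X = "\<Union>F" and ?Y = "\<Union>F'"
  let ?Z = "{e \<in> E. \<not> e \<subseteq> ?X \<and> \<not> e \<subseteq> ?Y}"
  have F: "F \<subseteq> E" "F \<noteq> {}" "F' \<subseteq> E" "F' \<noteq> {}" "card F = card ?X" "card F' = card ?Y"
    using assms by (simp_all add: tight_def)
  note fin = finite_edge_subset[OF F(1)] finite_edge_subset[OF F(3)]
  have "F \<inter> F' = {}"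
    using disj Union_nonempty[of "F \<inter> F'"] F by blast
  have "card (V - (?X \<union> ?Y)) < card ?Z"
    using F fin Union_nonempty disj by (intro card_edges_leaving_two) auto
  moreover have "card ?X + card ?Y = card (?X \<union> ?Y)"
    using fin disj by (intro card_Un_disjoint[symmetric]) auto
  moreover have "card F + card F' = card (F \<union> F')"
    using fin \<open>F \<inter> F' = {}\<close> by (intro card_Un_disjoint[symmetric]) auto
  moreover have "card (F \<union> F') + card ?Z = card (F \<union> F' \<union> ?Z)"
    using fin finite_E by (intro card_Un_disjoint[symmetric]) auto
  moreover have "\<dots> \<le> card V"
    unfolding card_E[symmetric] using finite_E F by (intro card_mono) auto
  moreover have "card (V - (?X \<union> ?Y)) = card V - card (?X \<union> ?Y)" "card (?X \<union> ?Y) \<le> card V"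
    using fin finite_V by (auto intro!: card_Diff_subset card_mono)
  ultimately show False using F by linarith
qed

text \<open>Cardinality is modular on edges and on vertices. Since the union of the two sets has at
  most as many edges as vertices, the intersection has at least as many.\<close>

lemma tight_inter:
  assumes "tight F" "tight F'"
  shows "tight (F \<inter> F')"
proof -
  have F: "F \<subseteq> E" "F \<noteq> {}" "F' \<subseteq> E" "F' \<noteq> {}" "card F = card (\<Union>F)" "card F' = card (\<Union>F')"
    using assms by (simp_all add: tight_def)
  note fin = finite_edge_subset[OF F(1)] finite_edge_subset[OF F(3)]
  have "card F + card F' = card (F \<union> F') + card (F \<inter> F')"
    using fin by (intro card_Un_Int) auto
  moreover have "card (\<Union>F) + card (\<Union>F') = card (\<Union>F \<union> \<Union>F') + card (\<Union>F \<inter> \<Union>F')"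
    using fin by (intro card_Un_Int) auto
  moreover have "card (F \<union> F') \<le> card (\<Union>F \<union> \<Union>F')"
    using card_le_card_Union[of "F \<union> F'"] F by (auto simp: Union_Un_distrib)
  ultimately have ge: "card (\<Union>F \<inter> \<Union>F') \<le> card (F \<inter> F')" using F by linarith
  moreover have "card (\<Union>F \<inter> \<Union>F') > 0"
    using tight_inter_nonempty[OF assms] fin by (simp add: card_gt_0_iff)
  ultimately have ne: "F \<inter> F' \<noteq> {}" by auto
  moreover have "card (\<Union>(F \<inter> F')) \<le> card (\<Union>F \<inter> \<Union>F')"
    using fin by (intro card_mono) auto
  moreover have "card (F \<inter> F') \<le> card (\<Union>(F \<inter> F'))"
    using F ne by (intro card_le_card_Union) auto
  ultimately show ?thesis using ge F by (auto simp: tight_def)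
qed

section \<open>Degrees in tight sets, and the cycle\<close>

lemma degree_pos:
  assumes "x \<in> V"
  shows "degree E x \<ge> 1"
proof -
  \<comment> \<open>A single vertex carries no edge, against \<open>card E = card V\<close>.\<close>
  have "V \<noteq> {x}"
  proof
    assume V: "V = {x}"
    then have "e \<notin> E" for e using edge[of e] card_mono[of "{x}" e] by fastforce
    then have "E = {}" by blast
    then show False using V card_E by simp
  qed
  then obtain y where "{x, y} \<in> E" using crossing[of "{x}"] assms by auto
  then have "{e \<in> E. x \<in> e} \<noteq> {}" by blast
  then show ?thesis
    unfolding degree_def using finite_E by (simp add: Suc_le_eq card_gt_0_iff)
qed

lemma Union_E: "\<Union>E = V"
proof
  show "V \<subseteq> \<Union>E"
  proof
    fix x assume "x \<in> V"
    then have "{e \<in> E. x \<in> e} \<noteq> {}" using degree_pos[of x] unfolding degree_def by force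
    then show "x \<in> \<Union>E" by blast
  qed
qed (use edge in auto)

lemma tight_E: "tight E"
  using Union_E card_E V_nonempty by (auto simp: tight_def)

text \<open>By handshaking the average degree in a tight set is exactly 2.\<close>

lemma degree_eq_two:
  assumes "tight F" "\<And>x. x \<in> \<Union>F \<Longrightarrow> degree F x \<ge> 2" "x \<in> \<Union>F"
  shows "degree F x = 2"
proof (rule ccontr)
  assume "degree F x \<noteq> 2"
  then have "2 < degree F x" using assms(2)[OF assms(3)] by simp
  then have "(\<Sum>x\<in>\<Union>F. 2) < (\<Sum>x\<in>\<Union>F. degree F x)"
    using assms finite_edge_subset[of F]
    by (intro sum_strict_mono_ex1) (auto simp: tight_def)
  then show False using sum_degree[of F] assms(1) by (auto simp: tight_def)
qed

text \<open>The cycle appears as the least tight set of edges.\<close>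

lemma ex_cycle: "\<exists>C. tight C \<and> (\<forall>F. tight F \<longrightarrow> C \<subseteq> F) \<and> (\<forall>x\<in>\<Union>C. degree C x = 2)"
proof -
  obtain C where C: "tight C" and least: "\<And>F. tight F \<Longrightarrow> card C \<le> card F"
    using ex_has_least_nat[of tight E card] tight_E by blast
  have CE: "C \<subseteq> E" "C \<noteq> {}" "card C = card (\<Union>C)" using C by (auto simp: tight_def)
  note fin = finite_edge_subset[OF CE(1)]
  \<comment> \<open>Least in cardinality becomes least in inclusion, by closure under
    intersection.\<close>
  have sub: "C \<subseteq> F" if "tight F" for F
  proof -
    have "card C \<le> card (C \<inter> F)" using least tight_inter[OF C that] by simp
    then have "C \<inter> F = C" using fin by (intro card_seteq) auto
    then show ?thesis by blast
  qed
  have deg: "degree C x \<ge> 2" if x: "x \<in> \<Union>C" for x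
  proof (rule ccontr)
    assume "\<not> degree C x \<ge> 2"
    moreover have "degree C x > 0"
      using x fin unfolding degree_def by (auto simp: card_gt_0_iff)
    ultimately have "degree C x = 1" by simp
    then obtain e where e: "{e \<in> C. x \<in> e} = {e}"
      unfolding degree_def by (auto simp: card_1_singleton_iff)
    then have eC: "e \<in> C" "x \<in> e" by auto
    \<comment> \<open>Removing the only edge at \<open>x\<close> costs one edge and at least the
      vertex \<open>x\<close>, so a smaller tight set would remain.\<close>
    let ?F = "C - {e}"
    have card_F: "card ?F = card C - 1" using eC by simp
    have "\<Union>?F \<subseteq> \<Union>C - {x}" using e by auto
    then have "card (\<Union>?F) \<le> card (\<Union>C - {x})" using fin by (intro card_mono) auto
    then have le: "card (\<Union>?F) \<le> card ?F" using card_F CE x fin by simp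
    have "?F \<noteq> {}"
    proof
      assume "?F = {}"
      then have "C = {e}" using eC by blast
      then show False using CE edge[of e] by simp
    qed
    moreover from this have "card ?F \<le> card (\<Union>?F)" using CE by (intro card_le_card_Union) auto
    ultimately have "tight ?F" using le CE by (auto simp: tight_def)
    then show False using sub eC by blast
  qed
  then show ?thesis using C sub degree_eq_two by blast
qed

section \<open>Stuck black sets and their white edges\<close>

definition stuck :: "'a set \<Rightarrow> bool" where
  "stuck B \<longleftrightarrow> B \<subseteq> V \<and> (\<forall>x\<in>B. \<forall>y. {z \<in> V - B. {x, z} \<in> E} \<noteq> {y})"

definition white_edges :: "'a set \<Rightarrow> 'a set set" where
  "white_edges B = {e \<in> E. e - B \<noteq> {}}"

lemma white_edges_subset: "white_edges B \<subseteq> E"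
  by (auto simp: white_edges_def)

lemma degree_white_edges_white: "x \<notin> B \<Longrightarrow> degree (white_edges B) x = degree E x"
  unfolding degree_def white_edges_def by (rule arg_cong[where f = card]) auto

text \<open>A black vertex with a white neighbour must have a second one, or else it would
  force.\<close>

lemma degree_white_edges_black:
  assumes "stuck B" "x \<in> B" "x \<in> \<Union>(white_edges B)"
  shows "degree (white_edges B) x \<ge> 2"
proof -
  let ?N = "{z \<in> V - B. {x, z} \<in> E}"
  obtain e where e: "e \<in> E" "x \<in> e" "e - B \<noteq> {}" using assms by (auto simp: white_edges_def)
  then obtain y where "y \<in> V" "e = {x, y}" using edge_pair by blast
  then have "y \<in> ?N" using e assms by auto
  moreover have "?N \<noteq> {y}" using assms by (auto simp: stuck_def)
  ultimately obtain z where z: "z \<in> ?N" "z \<noteq> y" by blast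
  have "{{x, y}, {x, z}} \<subseteq> {e \<in> white_edges B. x \<in> e}"
    using z \<open>y \<in> ?N\<close> by (auto simp: white_edges_def)
  then have "card {{x, y}, {x, z}} \<le> degree (white_edges B) x"
    unfolding degree_def using finite_edge_subset[OF white_edges_subset] by (intro card_mono) auto
  moreover have "{x, y} \<noteq> {x, z}" using z by (auto simp: doubleton_eq_iff)
  ultimately show ?thesis by simp
qed

lemma white_edges_nonempty: "B \<subseteq> V \<Longrightarrow> B \<noteq> V \<Longrightarrow> white_edges B \<noteq> {}"
  using Union_E unfolding white_edges_def by blast

definition leaves :: "'a set" where
  "leaves = {x \<in> V. degree E x = 1}"

lemma degree_nonleaf: "x \<in> V \<Longrightarrow> x \<notin> leaves \<Longrightarrow> degree E x \<ge> 2"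
  using degree_pos[of x] by (auto simp: leaves_def)

text \<open>Handshaking leaves room for a single leaf, since 2 |F| is even.\<close>

lemma tight_if_one_exception:
  assumes "F \<subseteq> E" "F \<noteq> {}" "\<And>x. x \<in> \<Union>F \<Longrightarrow> x \<noteq> l \<Longrightarrow> degree F x \<ge> 2"
  shows "tight F"
proof -
  note fin = finite_edge_subset[OF assms(1)]
  have "card F \<ge> card (\<Union>F)"
  proof (cases "l \<in> \<Union>F")
    case True
    have "degree F l > 0" using True fin unfolding degree_def by (auto simp: card_gt_0_iff)
    have "2 * card F = degree F l + (\<Sum>x\<in>\<Union>F - {l}. degree F x)"
      using sum_degree[OF assms(1)] True fin by (simp add: sum.remove)
    moreover have "(\<Sum>x\<in>\<Union>F - {l}. 2) \<le> (\<Sum>x\<in>\<Union>F - {l}. degree F x)"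
      using assms by (intro sum_mono) auto
    moreover have "(\<Sum>x\<in>\<Union>F - {l}. 2) = 2 * (card (\<Union>F) - 1)" "card (\<Union>F) > 0"
      using True fin by (auto simp: card_gt_0_iff)
    ultimately show ?thesis using \<open>degree F l > 0\<close> by linarith
  next
    case False
    then have "(\<Sum>x\<in>\<Union>F. 2) \<le> (\<Sum>x\<in>\<Union>F. degree F x)"
      using assms by (intro sum_mono) auto
    then show ?thesis using sum_degree[OF assms(1)] by simp
  qed
  then show ?thesis using assms card_le_card_Union[of F] by (auto simp: tight_def)
qed

text \<open>Without leaves the tight set \<open>E\<close> would be 2-regular. This supplies the leaf
  to be traded when there are two branch vertices.\<close>

lemma ex_leaf:
  assumes "x \<in> V" "degree E x \<ge> 3"
  shows "leaves \<noteq> {}"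
proof
  assume "leaves = {}"
  then have "degree E y \<ge> 2" if "y \<in> \<Union>E" for y using degree_nonleaf that Union_E by auto
  then have "degree E x = 2" using degree_eq_two[OF tight_E] assms Union_E by auto
  then show False using assms by simp
qed

section \<open>Paths and general position\<close>

definition path :: "'a list \<Rightarrow> bool" where
  "path p \<longleftrightarrow> distinct p \<and> set p \<subseteq> V \<and> successively (\<lambda>x y. {x, y} \<in> E) p"

text \<open>The predecessor and the successor of \<open>m\<close> give two different edges at
  \<open>m\<close>.\<close>

lemma inner_not_leaf:
  assumes "path (p @ m # q)" "p \<noteq> []" "q \<noteq> []"
  shows "m \<notin> leaves"
proof -
  have "{last p, m} \<in> E" "{m, hd q} \<in> E"
    using assms by (auto simp: path_def successively_append_iff successively_Cons)
  moreover have "set p \<inter> set q = {}" using assms by (auto simp: path_def)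
  then have ne: "last p \<noteq> hd q" using assms last_in_set hd_in_set by fastforce
  ultimately have sub: "{{m, last p}, {m, hd q}} \<subseteq> {e \<in> E. m \<in> e}" by (auto simp: insert_commute)
  have "card {{m, last p}, {m, hd q}} \<le> degree E m"
    unfolding degree_def using finite_E sub by (intro card_mono) auto
  moreover have "{m, last p} \<noteq> {m, hd q}" using ne by (auto simp: doubleton_eq_iff)
  ultimately show ?thesis by (auto simp: leaves_def)
qed

text \<open>Stronger than general position: all paths are tested instead of shortest ones only, so
  distances never enter.\<close>

definition in_general_position :: "'a set \<Rightarrow> bool" where
  "in_general_position R \<longleftrightarrow> R \<subseteq> V \<and> (\<forall>p T. path p \<and> T \<subseteq> set p \<and> T \<subseteq> R \<longrightarrow> card T \<noteq> 3)"

lemma leaves_in_general_position: "in_general_position leaves"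
  unfolding in_general_position_def
proof (intro conjI allI impI notI; (elim conjE)?)
  fix p T assume "path p" "T \<subseteq> set p" "T \<subseteq> leaves" "card T = 3"
  moreover from this obtain q m r where "p = q @ m # r" "m \<in> T" "set q \<inter> T \<noteq> {}" "set r \<inter> T \<noteq> {}"
    using triple_split_list by metis
  moreover from this have "q \<noteq> []" "r \<noteq> []" by auto
  ultimately show False using inner_not_leaf[of q m r] by blast
qed (auto simp: leaves_def)

text \<open>The two edges of \<open>C\<close> at \<open>x\<close> already exhaust the degree of
  \<open>x\<close>.\<close>

lemma cycle_degree_two_edges:
  assumes "C \<subseteq> E" "degree C x = 2" "degree E x = 2" "e \<in> E" "x \<in> e"
  shows "e \<in> C"
proof -
  have "{e \<in> C. x \<in> e} = {e \<in> E. x \<in> e}"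
    using assms finite_E by (intro card_seteq) (auto simp: degree_def)
  then show ?thesis using assms by auto
qed

text \<open>Leaves are never inner on a path, so \<open>a\<close> would be the middle point, with a
  leaf on either side. The cycle can be left only through \<open>v\<close>, hence the path would
  visit \<open>v\<close> both before and after \<open>a\<close>.\<close>

lemma leaves_and_cycle_vertex_in_general_position:
  assumes C: "C \<subseteq> E" "\<And>x. x \<in> \<Union>C \<Longrightarrow> degree C x = 2"
    and v: "\<And>x. x \<in> \<Union>C \<Longrightarrow> x \<noteq> v \<Longrightarrow> degree E x = 2"
    and a: "a \<in> \<Union>C" "a \<noteq> v"
  shows "in_general_position (insert a leaves)"
  unfolding in_general_position_def
proof (intro conjI allI impI notI; (elim conjE)?)
  show "insert a leaves \<subseteq> V" using a C Union_E by (auto simp: leaves_def)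
next
  fix p T assume p: "path p" "T \<subseteq> set p" and T: "T \<subseteq> insert a leaves" "card T = 3"
  obtain q m r where split: "p = q @ m # r" "m \<in> T" and ends: "set q \<inter> T \<noteq> {}" "set r \<inter> T \<noteq> {}"
    using triple_split_list p T by metis
  have "q \<noteq> []" "r \<noteq> []" using ends by auto
  then have "m \<notin> leaves" using inner_not_leaf[of q m r] p split by blast
  then have "m = a" using split T by auto
  let ?P = "\<lambda>x y. {x, y} \<in> E"
  define X where "X = \<Union>C - {v}"
  have dist: "distinct (q @ a # r)" and succ: "successively ?P (q @ a # r)"
    using p split \<open>m = a\<close> by (auto simp: path_def)
  have leaf_X: "x \<notin> X" if "x \<in> leaves" for x
    using that degree_mono[OF finite_E C(1), of x] C(2)[of x] by (auto simp: X_def leaves_def)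
  have enter: "v \<in> set s" if s: "successively ?P (s @ [a])" "set s \<inter> T \<noteq> {}" "a \<notin> set s" for s
  proof -
    obtain x where "x \<in> set s" "x \<in> leaves" using s T by auto
    then obtain y t where y: "y \<in> set s" "t \<in> X" "y \<notin> X" "{y, t} \<in> E"
      using successively_enters[OF s(1), of X x] a leaf_X by (auto simp: X_def)
    \<comment> \<open>As \<open>t\<close> has degree 2, an edge entering \<open>X\<close> at
      \<open>t\<close> belongs to \<open>C\<close>; its outer end is then a cycle vertex outside
      \<open>X\<close>, that is \<open>v\<close>.\<close>
    have "{y, t} \<in> C"
      by (rule cycle_degree_two_edges[of C t]) (use y C v in \<open>auto simp: X_def\<close>)
    then show ?thesis using y by (auto simp: X_def)
  qed
  have "v \<in> set q"
    using succ ends dist by (intro enter) (auto simp: successively_append_iff successively_Cons)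
  moreover have "v \<in> set (rev r)"
  proof (rule enter)
    have "successively ?P (a # r)" using succ by (auto simp: successively_append_iff)
    then have "successively (\<lambda>x y. ?P y x) (rev (a # r))" by (subst successively_rev) simp
    then show "successively ?P (rev r @ [a])" by (simp add: insert_commute)
  qed (use ends dist in auto)
  ultimately show False using dist by auto
qed

section \<open>Forcing sets\<close>

lemma degree_white_edges_ge_two:
  assumes "stuck B" "x \<in> \<Union>(white_edges B)" "x \<in> leaves \<Longrightarrow> x \<in> B"
  shows "degree (white_edges B) x \<ge> 2"
proof (cases "x \<in> B")
  case True
  then show ?thesis by (rule degree_white_edges_black[OF assms(1) _ assms(2)])
next
  case False
  moreover have "x \<in> V" using assms(2) white_edges_subset Union_E by blast
  ultimately show ?thesis using degree_nonleaf[of x] assms(3) by (auto simp: degree_white_edges_white)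
qed

lemma tight_white_edges:
  assumes "stuck B" "B \<noteq> V" "leaves - {l} \<subseteq> B"
  shows "tight (white_edges B)"
proof (rule tight_if_one_exception[of _ l])
  show "white_edges B \<noteq> {}" using assms white_edges_nonempty by (simp add: stuck_def)
  show "degree (white_edges B) x \<ge> 2" if "x \<in> \<Union>(white_edges B)" "x \<noteq> l" for x
    by (rule degree_white_edges_ge_two[OF assms(1) that(1)]) (use assms(3) that(2) in auto)
qed (rule white_edges_subset)

lemma degree_white_edges_eq_two:
  assumes "stuck B" "B \<noteq> V" "leaves \<subseteq> B" "x \<in> \<Union>(white_edges B)"
  shows "degree (white_edges B) x = 2"
proof (rule degree_eq_two[OF _ _ assms(4)])
  show "tight (white_edges B)"
    by (rule tight_white_edges[OF assms(1,2)]) (use assms(3) in auto)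
  show "degree (white_edges B) y \<ge> 2" if "y \<in> \<Union>(white_edges B)" for y
    by (rule degree_white_edges_ge_two[OF assms(1) that]) (use assms(3) in auto)
qed

text \<open>Phrased by stuck supersets rather than sequences of forces;
  \<open>color_change_rtranclp_verts\<close> recovers an actual sequence.\<close>

definition forces :: "'a set \<Rightarrow> bool" where
  "forces S \<longleftrightarrow> S \<subseteq> V \<and> (\<forall>B. S \<subseteq> B \<longrightarrow> stuck B \<longrightarrow> B = V)"

text \<open>A white vertex keeps its full degree in \<open>white_edges B\<close>, where all degrees
  are 2.\<close>

lemma high_degree_black:
  assumes B: "stuck B" "B \<noteq> V" "leaves \<subseteq> B" and "x \<in> \<Union>(white_edges B)" "degree E x \<noteq> 2"
  shows "x \<in> B"
  using degree_white_edges_eq_two[OF B assms(4)] degree_white_edges_white[of x B] assms(5) by auto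

text \<open>In a proper stuck superset the cycle edge \<open>{v, a}\<close> would have a white end,
  but \<open>a\<close> is black by choice and \<open>v\<close> by
  \<open>high_degree_black\<close>.\<close>

lemma forces_cycle_edge_at_branch:
  assumes C: "C \<subseteq> E" "\<And>F. tight F \<Longrightarrow> C \<subseteq> F"
    and e: "{v, a} \<in> C" "degree E v \<ge> 3"
  shows "forces (insert a leaves)"
  unfolding forces_def
proof (intro conjI allI impI)
  show "insert a leaves \<subseteq> V" using e C Union_E by (auto simp: leaves_def)
  fix B assume B: "insert a leaves \<subseteq> B" "stuck B"
  show "B = V"
  proof (rule ccontr)
    assume "B \<noteq> V"
    then have "tight (white_edges B)" using B by (intro tight_white_edges[of B a]) auto
    then have "C \<subseteq> white_edges B" by (rule C(2))
    then have va: "{v, a} \<in> white_edges B" using e by blast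
    then have "v \<in> B" using high_degree_black[of B v] B \<open>B \<noteq> V\<close> e by auto
    then show False using va B by (auto simp: white_edges_def)
  qed
qed

text \<open>No edge leaves a cycle whose vertices all have degree 2, so by connectedness the cycle
  is the whole graph.\<close>

lemma leaves_empty_if_no_branch:
  assumes C: "C \<subseteq> E" "C \<noteq> {}" "\<And>x. x \<in> \<Union>C \<Longrightarrow> degree C x = 2"
    "\<And>x. x \<in> \<Union>C \<Longrightarrow> degree E x = 2"
  shows "leaves = {}"
proof -
  have "\<Union>C = V"
  proof (rule ccontr)
    assume "\<Union>C \<noteq> V"
    moreover have "\<Union>C \<subseteq> V" using finite_edge_subset[OF C(1)] by simp
    ultimately obtain x y where xy: "x \<in> \<Union>C" "y \<in> V - \<Union>C" "{x, y} \<in> E"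
      using crossing[OF _ Union_nonempty[OF C(1,2)]] by meson
    have "{x, y} \<in> C"
      by (rule cycle_degree_two_edges[OF C(1) C(3)[OF xy(1)] C(4)[OF xy(1)] xy(3)]) simp
    then show False using xy(2) by blast
  qed
  then show ?thesis using C(4) by (auto simp: leaves_def)
qed

text \<open>
  If neither set forces, both stuck sets keep the leaf \<open>l\<close> white, and in either subgraph of white
  edges only the corresponding branch vertex has degree above 2. Their intersection would then be
  tight with all degrees at most 2 and degree 1 at \<open>l\<close>, against handshaking.
\<close>

lemma forces_at_one_of_two_branches:
  assumes C: "C \<subseteq> E" "\<And>F. tight F \<Longrightarrow> C \<subseteq> F"
    and u: "{u, a} \<in> C" "degree E u \<ge> 3" and v: "{v, b} \<in> C" "degree E v \<ge> 3"
    and "u \<noteq> v" "l \<in> leaves"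
  shows "forces (insert a (leaves - {l})) \<or> forces (insert b (leaves - {l}))"
proof (rule ccontr)
  assume not: "\<not> ?thesis"
  have fail: "\<exists>F. tight F \<and> l \<in> \<Union>F \<and> degree F l \<le> 1 \<and> (\<forall>x\<in>\<Union>F. x \<noteq> w \<longrightarrow> degree F x \<le> 2)"
    if w: "{w, c} \<in> C" "degree E w \<ge> 3" and nf: "\<not> forces (insert c (leaves - {l}))" for w c
  proof -
    have "insert c (leaves - {l}) \<subseteq> V" using w C Union_E by (auto simp: leaves_def)
    then obtain B where B: "insert c (leaves - {l}) \<subseteq> B" "stuck B" "B \<noteq> V"
      using nf by (auto simp: forces_def)
    let ?F = "white_edges B"
    have t: "tight ?F" by (rule tight_white_edges[OF B(2,3)]) (use B in auto)
    then have FE: "?F \<subseteq> E" and "C \<subseteq> ?F" and fin: "finite (\<Union>?F)" and card: "card ?F = card (\<Union>?F)"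
      using C finite_edge_subset by (auto simp: tight_def)
    then have wc: "{w, c} \<in> ?F" using w by blast
    \<comment> \<open>The edge \<open>{w, c}\<close> has a white end and \<open>c\<close> is
      black.\<close>
    then have "w \<notin> B" using B by (auto simp: white_edges_def)
    then have dw: "degree ?F w \<ge> 3" using w degree_white_edges_white by simp
    have wF: "w \<in> \<Union>?F" using wc by auto
    have lB: "l \<notin> B"
    proof
      assume "l \<in> B"
      then have "leaves \<subseteq> B" using B by auto
      then show False using high_degree_black[of B w] B wF w \<open>w \<notin> B\<close> by auto
    qed
    have dl: "degree ?F l = 1" using degree_white_edges_white[OF lB] \<open>l \<in> leaves\<close> by (simp add: leaves_def)
    have lF: "l \<in> \<Union>?F"
    proof (rule ccontr)
      assume "l \<notin> \<Union>?F"
      then have "{e \<in> ?F. l \<in> e} = {}" by blast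
      then have "degree ?F l = 0" by (simp only: degree_def card.empty)
      then show False using dl by simp
    qed
    have "l \<noteq> w" using dl dw by auto
    have ge: "degree ?F x \<ge> 2" if "x \<in> \<Union>?F" "x \<noteq> l" for x
      by (rule degree_white_edges_ge_two[OF B(2) that(1)]) (use B(1) that(2) in auto)
    have "degree ?F x \<le> 2" if x: "x \<in> \<Union>?F" "x \<noteq> w" for x
    proof (cases "x = l")
      case False
      \<comment> \<open>Measured against the average 2, \<open>l\<close> falls short by 1,
        \<open>w\<close> exceeds it by at least 1 and the vertices of \<open>R\<close> do not fall
        short. Nothing is left for \<open>x\<close> to exceed it.\<close>
      define R where "R = \<Union>?F - {l, w, x}"
      have U: "\<Union>?F = insert l (insert w (insert x R))" using lF wF x(1) unfolding R_def by blast
      have R: "finite R" "l \<notin> R" "w \<notin> R" "x \<notin> R" using fin by (auto simp: R_def)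
      have "(\<Sum>y\<in>\<Union>?F. degree ?F y) = degree ?F l + (degree ?F w + (degree ?F x + (\<Sum>y\<in>R. degree ?F y)))"
        unfolding U using R x(2) \<open>l \<noteq> w\<close> False by simp
      moreover have "(\<Sum>y\<in>R. 2) \<le> (\<Sum>y\<in>R. degree ?F y)"
        using ge by (intro sum_mono) (simp add: R_def)
      moreover have "card (\<Union>?F) = Suc (Suc (Suc (card R)))"
        unfolding U using R x(2) \<open>l \<noteq> w\<close> False by simp
      ultimately show ?thesis using sum_degree[OF FE] card dl dw by simp
    qed (use dl in simp)
    then show ?thesis using t lF dl by (intro exI[of _ ?F]) auto
  qed
  obtain F where F: "tight F" "l \<in> \<Union>F" "degree F l \<le> 1" "\<And>x. x \<in> \<Union>F \<Longrightarrow> x \<noteq> u \<Longrightarrow> degree F x \<le> 2"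
    using fail[OF u] not by blast
  obtain F' where F': "tight F'" "l \<in> \<Union>F'" "degree F' l \<le> 1" "\<And>x. x \<in> \<Union>F' \<Longrightarrow> x \<noteq> v \<Longrightarrow> degree F' x \<le> 2"
    using fail[OF v] not by blast
  let ?D = "F \<inter> F'"
  have t: "tight ?D" by (rule tight_inter[OF F(1) F'(1)])
  have FE: "F \<subseteq> E" "F' \<subseteq> E" using F(1) F'(1) by (auto simp: tight_def)
  note fin = finite_edge_subset[OF FE(1)] finite_edge_subset[OF FE(2)]
  have le: "degree ?D x \<le> degree F x" "degree ?D x \<le> degree F' x" for x
    using fin by (auto intro: degree_mono)
  \<comment> \<open>Every \<open>x\<close> differs from \<open>u\<close> or from \<open>v\<close>,
    and so is bounded in \<open>F\<close> or in \<open>F'\<close>.\<close>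
  have le2: "degree ?D x \<le> 2" if "x \<in> \<Union>?D" for x
  proof -
    have "x \<in> \<Union>F" "x \<in> \<Union>F'" using that by auto
    then show ?thesis using F(4) F'(4) le[of x] \<open>u \<noteq> v\<close> by (metis le_trans)
  qed
  obtain e e' where e: "e \<in> F" "l \<in> e" "e' \<in> F'" "l \<in> e'" using F(2) F'(2) by blast
  \<comment> \<open>The only edge at the leaf \<open>l\<close> belongs to both sets, so
    \<open>l\<close> remains a vertex of the intersection.\<close>
  have "card {e \<in> E. l \<in> e} = 1" using \<open>l \<in> leaves\<close> by (simp add: leaves_def degree_def)
  then obtain d where d: "{e \<in> E. l \<in> e} = {d}" by (rule card_1_singletonE)
  have "e \<in> {e \<in> E. l \<in> e}" "e' \<in> {e \<in> E. l \<in> e}" using e FE by auto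
  then have "e = e'" unfolding d by simp
  then have lD: "l \<in> \<Union>?D" using e by blast
  have "(\<Sum>x\<in>\<Union>?D. degree ?D x) < (\<Sum>x\<in>\<Union>?D. 2)"
  proof (rule sum_strict_mono_ex1)
    have "degree ?D l < 2" using le(1)[of l] F(3) by simp
    then show "\<exists>x\<in>\<Union>?D. degree ?D x < 2" using lD by blast
    show "finite (\<Union>?D)" using finite_edge_subset[of ?D] t by (simp add: tight_def)
  qed (use le2 in auto)
  then show False using t sum_degree[of ?D] by (auto simp: tight_def)
qed

section \<open>The cases of no, one, or several branch vertices\<close>

theorem ex_forcing_general_position: "\<exists>S R. forces S \<and> in_general_position R \<and> card S \<le> card R"
proof -
  obtain C where "tight C" and least: "\<And>F. tight F \<Longrightarrow> C \<subseteq> F"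
    and deg: "\<And>x. x \<in> \<Union>C \<Longrightarrow> degree C x = 2"
    using ex_cycle by blast
  then have CE: "C \<subseteq> E" "C \<noteq> {}" by (auto simp: tight_def)
  have neighbour: "\<exists>y. {x, y} \<in> C \<and> x \<noteq> y" if "x \<in> \<Union>C" for x
    using that edge_pair CE by blast
  have ge2: "degree E x \<ge> 2" if "x \<in> \<Union>C" for x
    using deg[OF that] degree_mono[OF finite_E CE(1), of x] by simp
  define A where "A = {x \<in> \<Union>C. degree E x \<ge> 3}"
  have two: "degree E x = 2" if "x \<in> \<Union>C" "x \<notin> A" for x
    using ge2[OF that(1)] that by (auto simp: A_def)
  consider "A = {}" | v where "A = {v}" | u v where "u \<in> A" "v \<in> A" "u \<noteq> v" by blast
  then show ?thesis
  proof cases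
    case 1
    then have no_leaf: "leaves = {}" using leaves_empty_if_no_branch CE deg two by auto
    obtain a where "a \<in> \<Union>C" using Union_nonempty[OF CE] by blast
    then obtain b where ab: "{a, b} \<in> C" "a \<noteq> b" using neighbour by meson
    then have sub: "{a, b} \<subseteq> V" using CE Union_E by auto
    have "forces {a, b}"
      unfolding forces_def
    proof (intro conjI allI impI)
      fix B assume B: "{a, b} \<subseteq> B" "stuck B"
      show "B = V"
      proof (rule ccontr)
        assume "B \<noteq> V"
        then have "{a, b} \<in> white_edges B"
          \<comment> \<open>There are no leaves, so \<open>a\<close> merely fills the place of the
            exceptional leaf.\<close>
          using tight_white_edges[of B a] B no_leaf least ab by auto
        then show False using B by (auto simp: white_edges_def)
      qed
    qed (fact sub)
    moreover have "card T \<noteq> 3" if "T \<subseteq> {a, b}" for T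
      using card_mono[OF _ that] ab by simp
    then have "in_general_position {a, b}"
      using sub by (auto simp: in_general_position_def)
    ultimately show ?thesis by blast
  next
    case (2 v)
    then have v: "v \<in> \<Union>C" "degree E v \<ge> 3" by (auto simp: A_def)
    then obtain a where a: "{v, a} \<in> C" "v \<noteq> a" using neighbour by meson
    have "forces (insert a leaves)"
      using forces_cycle_edge_at_branch CE least a v by blast
    moreover have "in_general_position (insert a leaves)"
      by (rule leaves_and_cycle_vertex_in_general_position[of C v]) (use CE deg two 2 a in auto)
    ultimately show ?thesis by blast
  next
    case (3 u v)
    then have uv: "u \<in> \<Union>C" "degree E u \<ge> 3" "v \<in> \<Union>C" "degree E v \<ge> 3" by (auto simp: A_def)
    obtain a b where ab: "{u, a} \<in> C" "{v, b} \<in> C" using neighbour uv by meson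
    have "u \<in> V" using uv CE Union_E by auto
    then obtain l where l: "l \<in> leaves" using ex_leaf uv by blast
    have "card (insert c (leaves - {l})) \<le> card leaves" for c
    proof -
      have "finite leaves" using finite_V by (auto simp: leaves_def)
      then have "Suc (card (leaves - {l})) = card leaves" using l by (intro card_Suc_Diff1) auto
      then show ?thesis using card_insert_le_m1[of "card leaves" "leaves - {l}" c] by simp
    qed
    then show ?thesis
      using forces_at_one_of_two_branches[OF CE(1) least ab(1) uv(2) ab(2) uv(4) 3(3) l]
        leaves_in_general_position by blast
  qed
qed

end

section \<open>Transfer to symmetric digraphs\<close>

text \<open>Force greedily: every step blackens one more vertex, and the supersets of the new black
  set are among those of the old one.\<close>

lemma color_change_rtranclp_verts:
  assumes "finite (verts G)" "S \<subseteq> verts G"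
    and stuck: "\<And>B. S \<subseteq> B \<Longrightarrow> B \<subseteq> verts G \<Longrightarrow> B \<noteq> verts G \<Longrightarrow> \<exists>B'. color_change G B B'"
  shows "(color_change G)\<^sup>*\<^sup>* S (verts G)"
  using assms(2,3)
proof (induction "card (verts G - S)" arbitrary: S rule: less_induct)
  case less
  show ?case
  proof (cases "S = verts G")
    case False
    then obtain S' where S': "color_change G S S'" using less.prems by blast
    then obtain y where y: "y \<in> verts G - S" "S' = insert y S"
      unfolding color_change_def by blast
    have "(color_change G)\<^sup>*\<^sup>* S' (verts G)"
    proof (rule less.hyps)
      show "card (verts G - S') < card (verts G - S)"
        using y assms(1) by (intro psubset_card_mono) auto
    qed (use y less.prems in auto)
    then show ?thesis using S' by simp
  qed simp
qed

lemma zero_forcing_number_le: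
  assumes "finite (verts G)" "zero_forcing_set G S"
  shows "zero_forcing_number G \<le> card S"
  unfolding zero_forcing_number_def
  by (rule Min_le) (use assms finite_zero_forcing_sets in auto)

lemma gp_number_ge:
  assumes "finite (verts G)" "general_position_set G R"
  shows "card R \<le> gp_number G"
  unfolding gp_number_def
  by (rule Max_ge) (use assms finite_general_position_sets in auto)

lemma successively_vwalk_arcs:
  "set (vwalk_arcs p) \<subseteq> A \<Longrightarrow> successively (\<lambda>x y. (x, y) \<in> A) p"
  by (induction p rule: vwalk_arcs.induct) auto

lemma (in sym_digraph) edges_iff: "{x, y} \<in> edges G \<longleftrightarrow> x \<rightarrow>\<^bsub>G\<^esub> y"
  using arcs_ends_symmetric[OF sym_arcs] by (auto simp: edges_def doubleton_eq_iff)

text \<open>A vertex set that no arc leaves is closed under reachability.\<close>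

lemma (in sym_digraph) connected_crossing:
  assumes "connected G" "X \<subseteq> verts G" "X \<noteq> {}" "X \<noteq> verts G"
  shows "\<exists>x\<in>X. \<exists>y\<in>verts G - X. x \<rightarrow>\<^bsub>G\<^esub> y"
proof (rule ccontr)
  assume closed: "\<not> ?thesis"
  obtain u v where uv: "u \<in> X" "v \<in> verts G - X" using assms by blast
  then have "u \<rightarrow>\<^sup>*\<^bsub>mk_symmetric G\<^esub> v"
    using assms unfolding connected_def strongly_connected_def by auto
  \<comment> \<open>Connectedness is defined through the symmetric closure, which has the same
    reachability as a symmetric digraph itself.\<close>
  then have "u \<rightarrow>\<^sup>*\<^bsub>G\<^esub> v" using reachable_mk_symmetric_eq[OF sym_arcs] by simp
  then have "v \<in> X"
  proof (induction rule: reachable_induct)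
    case (step x y)
    then show ?case using closed adj_in_verts(2)[of x y] by blast
  qed (use uv in simp)
  then show False using uv by blast
qed

theorem theorem2p1:
  fixes G :: "('a, 'b) pre_digraph"
  assumes "Digraph.graph G"
    and "Digraph_Component.connected G"
    and "card (edges G) = card (verts G)"
  shows "gp_number G \<ge> zero_forcing_number G"
proof -
  interpret graph G by fact
  interpret unicyclic "verts G" "edges G"
  proof
    fix e assume "e \<in> edges G"
    then obtain u v where "e = {u, v}" "u \<rightarrow>\<^bsub>G\<^esub> v" by (auto simp: edges_def)
    moreover from this have "u \<noteq> v" using adj_not_same by blast
    ultimately show "e \<subseteq> verts G \<and> card e = 2" using adj_in_verts[of u v] by auto
  next
    show "verts G \<noteq> {}" using assms(2) by (auto simp: connected_def strongly_connected_def)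
  qed (use assms connected_crossing in \<open>auto simp: edges_iff\<close>)
  obtain S R where S: "forces S" and R: "in_general_position R" and le: "card S \<le> card R"
    using ex_forcing_general_position by blast
  have "(color_change G)\<^sup>*\<^sup>* S (verts G)"
  proof (rule color_change_rtranclp_verts)
    fix B assume B: "S \<subseteq> B" "B \<subseteq> verts G" "B \<noteq> verts G"
    then have "\<not> stuck B" using S by (auto simp: forces_def)
    then obtain x y where "x \<in> B" "{z \<in> verts G - B. x \<rightarrow>\<^bsub>G\<^esub> z} = {y}"
      using B(2) unfolding stuck_def edges_iff by blast
    then show "\<exists>B'. color_change G B B'" unfolding color_change_def by blast
  qed (use S in \<open>auto simp: forces_def\<close>)
  then have "zero_forcing_set G S" using S by (auto simp: zero_forcing_set_def forces_def)
  moreover have "path p" if "shortest_path G p" for p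
  proof -
    have "distinct p" "set p \<subseteq> verts G" "set (vwalk_arcs p) \<subseteq> arcs_ends G"
      using that by (auto simp: shortest_path_def vpath_def vwalk_def)
    then show ?thesis using successively_vwalk_arcs[of p "arcs_ends G"] by (simp add: path_def edges_iff)
  qed
  then have "general_position_set G R"
    using R by (auto simp: general_position_set_def in_general_position_def)
  ultimately show ?thesis
    using zero_forcing_number_le gp_number_ge le finite_verts le_trans by metis
qed

end
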